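(* Let $\mathbb{S}$ be a totally ordered idempotent semifield, let $f\in\mathbb{S}[x_0,\dots,x_n]$ be a nonzero homogeneous polynomial, and let $I\subset\mathbb{S}[x_0,\dots,x_n]$ be a numerically principal tropical ideal of degree $\deg f$ (i.e. with the Hilbert function of a hypersurface of degree $\deg f$ in $\mathbb{P}^n$) such that $I_{\deg f}=\mathbb{S}f$. Then for every degree $d$, the underlying matroid of $I_d$ is a weak image of the underlying matroid of $[f]_d$, where $[f]$ is the Macaulay tropical ideal of $f$.
   Context: A totally ordered idempotent semifield $\mathbb{S}$ is a set with $0$ such that $\mathbb{S}\setminus\{0\}$ is a totally ordered abelian group (written multiplicatively), $0$ is the least element, and addition is maximum. A finite sum in $\mathbb{S}$ tropically vanishes if its value is unchanged by dropping any single term. Tropical linear spaces. For a finite set $E$, a valuated matroid of rank $r$ is a nonzero $p\in\mathbb{S}^{\binom{E}{r}}$ such that for all $A\in\binom{E}{r+1}$, $B\in\binom{E}{r-1}$ the sum $\sum_{i\in A\setminus B}p_{A\setminus\{i\}}p_{B\cup\{i\}}$ tropically vanishes. The tropical linear space $L_p\subset\mathbb{S}^E$ of rank $r$ is the $\mathbb{S}$-submodule spanned by the cocircuits $\beta_C=\sum_{i\notin C}p_{C\cup\{i\}}e_i$, $C\in\binom{E}{r-1}$; it determines $p$ up to a scalar. The underlying matroid of $L_p$ (or $p$) is the matroid on $E$ with bases $\{B:p_B\ne 0\}$. Tropical ideals. Let $\Delta^n_d$ be the set of degree $d$ monomials in $x_0,\dots,x_n$, $N^n_d=|\Delta^n_d|=\binom{n+d}{d}$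 for $d\ge0$ and $N^n_d=0$ for $d<0$. The degree $d$ part of $\mathbb{S}[x_0,\dots,x_n]$ is identified with $\mathbb{S}^{\Delta^n_d}$. A homogeneous ideal $J$ is a tropical ideal if each $J_d$ is a tropical linear space; its Hilbert function is $HF_J(d)=N^n_d-\operatorname{rank}(J_d)$. A tropical ideal $J$ has the Hilbert function of a degree $D$ hypersurface if $HF_J(d)=N^n_d-N^n_{d-D}$ for all $d\ge 0$; it is called numerically principal (of degree $D$) in that case. Macaulay tropical ideal. For $d\ge\deg(f)$ the Macaulay matrix $\mathcal{D}_d(f)$ has rows indexed by $\Delta^n_{d-\deg(f)}$, columns indexed by $\Delta^n_d$, and $(X,Y)$ entry the coefficient of $Y$ in $Xf$. Then $[f]_d$ is the tropical linear space $L_p$ where $p_B$, for $B\subset\Delta^n_d$ with $|B|=N^n_{d-\deg(f)}$, is the tropical maximal minor $\max_\sigma\prod_X\mathcal{D}_d(f)_{X,\sigma(X)}$ over bijections $\sigma:\Delta^n_{d-\deg(f)}\to B$ (the stable sum of the rows). For $d<\deg(f)$, $[f]_d=0$; and $[f]=\bigoplus_d[f]_d$. Given matroids $M,M'$ on the same ground set, $M'$ is a weak image of $M$ if every independent set of $M'$ is independent in $M$. *)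

theory Defs
  imports Main "HOL-Library.Poly_Mapping"
begin

section \<open>Totally ordered idempotent semifields\<close>

text \<open>
  The axioms imply that \<open>0\<close> is the least element (as \<open>a = 0 + a = max 0 a\<close>) and that
  multiplication is monotone (by distributivity), so the nonzero elements form a totally ordered
  abelian group.  This group may be trivial (the Boolean semifield).
\<close>

class totally_ordered_idempotent_semifield = comm_semiring_1 + linorder +
  assumes add_eq_max: "a + b = max a b"
    and ex_mult_inverse: "a \<noteq> 0 \<Longrightarrow> \<exists>b. a * b = 1"
begin

lemma zero_least: "0 \<le> a"
  by (metis add_0 add_eq_max max.cobounded1)

lemma add_eq_0_iff_both: "a + b = 0 \<longleftrightarrow> a = 0 \<and> b = 0"
  by (metis add_0 add_eq_max max.cobounded1 max.cobounded2 zero_least order.antisym)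

lemma mult_eq_0_iff_either: "a * b = 0 \<longleftrightarrow> a = 0 \<or> b = 0"
proof
  assume ab: "a * b = 0"
  show "a = 0 \<or> b = 0"
  proof (rule ccontr)
    assume nz: "\<not> (a = 0 \<or> b = 0)"
    then obtain c where ac: "a * c = 1" using ex_mult_inverse by blast
    have "b = (a * c) * b" using ac by simp
    also have "\<dots> = c * (a * b)" by (simp add: ac_simps)
    finally show False using ab nz by simp
  qed
qed auto

lemma idem_mult_left_mono: "a \<le> b \<Longrightarrow> c * a \<le> c * b"
  by (metis add_eq_max distrib_left max.absorb2 max.cobounded1)

end

lemma sum_eq_0_iff_all:
  fixes g :: "'b \<Rightarrow> 's::totally_ordered_idempotent_semifield"
  assumes "finite A"
  shows "sum g A = 0 \<longleftrightarrow> (\<forall>x\<in>A. g x = 0)"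
  using assms by (induction A) (auto simp: add_eq_0_iff_both)


section \<open>Valuated matroids and tropical linear spaces\<close>

definition tropically_vanishes ::
    "('i \<Rightarrow> 's::totally_ordered_idempotent_semifield) \<Rightarrow> 'i set \<Rightarrow> bool" where
  "tropically_vanishes g A \<longleftrightarrow> (\<forall>j\<in>A. (\<Sum>i\<in>A - {j}. g i) = (\<Sum>i\<in>A. g i))"

text \<open>
  A vector indexed by the \<open>r\<close>-subsets of \<open>E\<close> is a function on all sets that is \<open>0\<close> elsewhere.  The
  condition \<open>Suc (card B) = r\<close> says \<open>|B| = r - 1\<close> without truncated subtraction: for \<open>r = 0\<close>
  there are no such \<open>B\<close>.
\<close>

definition valuated_matroid ::
    "'e set \<Rightarrow> nat \<Rightarrow> ('e set \<Rightarrow> 's::totally_ordered_idempotent_semifield) \<Rightarrow> bool" where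
  "valuated_matroid E r p \<longleftrightarrow>
     finite E \<and>
     (\<forall>B. p B \<noteq> 0 \<longrightarrow> B \<subseteq> E \<and> card B = r) \<and>
     (\<exists>B. p B \<noteq> 0) \<and>
     (\<forall>A B. A \<subseteq> E \<and> card A = Suc r \<and> B \<subseteq> E \<and> Suc (card B) = r \<longrightarrow>
        tropically_vanishes (\<lambda>i. p (A - {i}) * p (insert i B)) (A - B))"

text \<open>Vectors indexed by \<open>E\<close> are functions on the whole type that vanish outside \<open>E\<close>.\<close>

definition cocircuit ::
    "'e set \<Rightarrow> ('e set \<Rightarrow> 's::totally_ordered_idempotent_semifield) \<Rightarrow> 'e set \<Rightarrow> 'e \<Rightarrow> 's" where
  "cocircuit E p C = (\<lambda>i. if i \<in> E - C then p (insert i C) else 0)"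

definition trop_linear_space ::
    "'e set \<Rightarrow> nat \<Rightarrow> ('e set \<Rightarrow> 's::totally_ordered_idempotent_semifield) \<Rightarrow> ('e \<Rightarrow> 's) set" where
  "trop_linear_space E r p =
     {v. \<exists>c. v = (\<lambda>i. \<Sum>C | C \<subseteq> E \<and> Suc (card C) = r. c C * cocircuit E p C i)}"

definition is_trop_linear_space ::
    "'e set \<Rightarrow> ('e \<Rightarrow> 's::totally_ordered_idempotent_semifield) set \<Rightarrow> bool" where
  "is_trop_linear_space E L \<longleftrightarrow> (\<exists>r p. valuated_matroid E r p \<and> L = trop_linear_space E r p)"

text \<open>
  The rank and the bases of the underlying matroid of a tropical linear space.  Both descriptions
  are well defined; see \<open>trop_rank_eq\<close> and \<open>underlying_bases_eq\<close> below.
\<close>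

definition trop_rank ::
    "'e set \<Rightarrow> ('e \<Rightarrow> 's::totally_ordered_idempotent_semifield) set \<Rightarrow> nat" where
  "trop_rank E L = (THE r. \<exists>p. valuated_matroid E r p \<and> L = trop_linear_space E r p)"

definition underlying_bases ::
    "'e set \<Rightarrow> ('e \<Rightarrow> 's::totally_ordered_idempotent_semifield) set \<Rightarrow> 'e set set" where
  "underlying_bases E L =
     (THE \<B>. \<exists>r p. valuated_matroid E r p \<and> L = trop_linear_space E r p \<and> \<B> = {B. p B \<noteq> 0})"

text \<open>Matroids on a given ground set are represented by their sets of bases.\<close>

definition indep_in :: "'e set set \<Rightarrow> 'e set \<Rightarrow> bool" where
  "indep_in \<B> A \<longleftrightarrow> (\<exists>B\<in>\<B>. A \<subseteq> B)"

definition weak_image :: "'e set set \<Rightarrow> 'e set set \<Rightarrow> bool" where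
  "weak_image \<B>' \<B> \<longleftrightarrow> (\<forall>A. indep_in \<B>' A \<longrightarrow> indep_in \<B> A)"


subsection \<open>Well-definedness of rank and underlying matroid\<close>

lemma valuated_matroid_exchange:
  assumes p: "valuated_matroid E r p"
    and B1: "p B1 \<noteq> 0" and B2: "p B2 \<noteq> 0" and x: "x \<in> B1 - B2"
  shows "\<exists>y\<in>B2 - B1. p (insert y (B1 - {x})) \<noteq> 0 \<and> p (insert x (B2 - {y})) \<noteq> 0"
proof -
  have fin: "finite E" and sub: "B1 \<subseteq> E" "B2 \<subseteq> E" and crd: "card B1 = r" "card B2 = r"
    using p B1 B2 by (auto simp: valuated_matroid_def)
  have fB: "finite B1" "finite B2" using fin sub finite_subset by auto
  let ?A = "insert x B2" and ?C = "B1 - {x}"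
  let ?g = "\<lambda>i. p (?A - {i}) * p (insert i ?C)"
  have "?A \<subseteq> E" "card ?A = Suc r" "?C \<subseteq> E" "Suc (card ?C) = r"
    using sub crd fB x card_Suc_Diff1[of B1 x] by auto
  then have tv: "tropically_vanishes ?g (?A - ?C)"
    using p unfolding valuated_matroid_def by blast
  have "?A - {x} = B2" "insert x ?C = B1" using x by auto
  then have gx: "?g x \<noteq> 0" using B1 B2 by (simp add: mult_eq_0_iff_either)
  have fA: "finite (?A - ?C)" using fB by auto
  have xA: "x \<in> ?A - ?C" by auto
  have "sum ?g (?A - ?C) \<noteq> 0"
  proof
    assume "sum ?g (?A - ?C) = 0"
    then have "\<forall>i\<in>?A - ?C. ?g i = 0" by (rule sum_eq_0_iff_all[OF fA, THEN iffD1])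
    then have "?g x = 0" using xA by (rule bspec)
    then show False using gx by contradiction
  qed
  moreover have "sum ?g ((?A - ?C) - {x}) = sum ?g (?A - ?C)"
    using tv xA unfolding tropically_vanishes_def by (rule bspec)
  ultimately have "sum ?g ((?A - ?C) - {x}) \<noteq> 0" by metis
  then obtain y where y: "y \<in> (?A - ?C) - {x}" "?g y \<noteq> 0"
    by (rule sum.not_neutral_contains_not_neutral)
  then have yB: "y \<in> B2 - B1" by blast
  then have "?A - {y} = insert x (B2 - {y})" using x by blast
  then have "p (insert x (B2 - {y})) * p (insert y ?C) \<noteq> 0" using y(2) by simp
  then have "p (insert y ?C) \<noteq> 0 \<and> p (insert x (B2 - {y})) \<noteq> 0"
    unfolding mult_eq_0_iff_either by blast
  then show ?thesis using yB by (rule rev_bexI[rotated])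
qed

lemma cocircuit_in_trop_linear_space:
  assumes fin: "finite E" and C: "C \<subseteq> E" "Suc (card C) = r"
  shows "cocircuit E p C \<in> trop_linear_space E r p"
proof -
  let ?c = "\<lambda>C'. if C' = C then 1 else 0"
  have fs: "finite {C. C \<subseteq> E \<and> Suc (card C) = r}" using fin by auto
  have "cocircuit E p C i =
      (\<Sum>C' | C' \<subseteq> E \<and> Suc (card C') = r. ?c C' * cocircuit E p C' i)" for i
    using fs C by (subst sum.mono_neutral_right[where S = "{C}"]) auto
  then have "cocircuit E p C =
      (\<lambda>i. \<Sum>C' | C' \<subseteq> E \<and> Suc (card C') = r. ?c C' * cocircuit E p C' i)" by (rule ext)
  then show ?thesis unfolding trop_linear_space_def by (intro CollectI exI[of _ ?c])
qed

definition meets_supports :: "('e \<Rightarrow> 's::zero) set \<Rightarrow> 'e set \<Rightarrow> bool" where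
  "meets_supports L B \<longleftrightarrow> (\<forall>v\<in>L. (\<exists>i. v i \<noteq> 0) \<longrightarrow> (\<exists>b\<in>B. v b \<noteq> 0))"

lemma basis_meets_supports:
  assumes p: "valuated_matroid E r p" and B: "p B \<noteq> 0"
  shows "meets_supports (trop_linear_space E r p) B"
  unfolding meets_supports_def
proof (intro ballI impI)
  fix v assume "v \<in> trop_linear_space E r p" and nz: "\<exists>i. v i \<noteq> 0"
  let ?S = "{C. C \<subseteq> E \<and> Suc (card C) = r}"
  obtain c where v: "v = (\<lambda>i. \<Sum>C\<in>?S. c C * cocircuit E p C i)"
    using \<open>v \<in> _\<close> unfolding trop_linear_space_def by auto
  have fs: "finite ?S" using p by (auto simp: valuated_matroid_def)
  obtain i where "v i \<noteq> 0" using nz by blast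
  then obtain C where C: "C \<in> ?S" "c C * cocircuit E p C i \<noteq> 0"
    unfolding v by (meson sum.neutral)
  then have cC: "c C \<noteq> 0" and i: "i \<in> E - C" "p (insert i C) \<noteq> 0"
    by (auto simp: cocircuit_def mult_eq_0_iff_either split: if_splits)
  have "\<exists>b\<in>B. cocircuit E p C b \<noteq> 0"
  proof (cases "i \<in> B")
    case True
    then show ?thesis using i by (auto simp: cocircuit_def)
  next
    case False
    then obtain y where y: "y \<in> B - insert i C" "p (insert y (insert i C - {i})) \<noteq> 0"
      using valuated_matroid_exchange[OF p i(2) B] by blast
    moreover have "insert i C - {i} = C" "B \<subseteq> E"
      using i p B by (auto simp: valuated_matroid_def)
    ultimately show ?thesis by (auto simp: cocircuit_def)
  qed
  then show "\<exists>b\<in>B. v b \<noteq> 0"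
    unfolding v using C(1) cC fs by (auto simp: sum_eq_0_iff_all mult_eq_0_iff_either)
qed

lemma meets_supports_contains_basis:
  assumes p: "valuated_matroid E r p" and B: "meets_supports (trop_linear_space E r p) D"
  shows "\<exists>B\<subseteq>D. p B \<noteq> 0"
proof -
  have fin: "finite E" using p by (simp add: valuated_matroid_def)
  obtain B0 where "p B0 \<noteq> 0" using p by (auto simp: valuated_matroid_def)
  moreover have "card (B \<inter> D) < Suc (card E)" if "p B \<noteq> 0" for B
    using that p fin by (auto simp: valuated_matroid_def intro!: le_imp_less_Suc card_mono)
  ultimately obtain B where B: "p B \<noteq> 0" and
    mx: "\<And>B'. p B' \<noteq> 0 \<Longrightarrow> card (B' \<inter> D) \<le> card (B \<inter> D)"
    using ex_has_greatest_nat[of "\<lambda>B. p B \<noteq> 0" B0 "\<lambda>B. card (B \<inter> D)" "Suc (card E)"] by blast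
  have "B \<subseteq> D"
  proof (rule ccontr)
    assume "\<not> B \<subseteq> D"
    then obtain x where x: "x \<in> B" "x \<notin> D" by blast
    have sB: "B \<subseteq> E" "card B = r" and fB: "finite B"
      using B p fin finite_subset by (auto simp: valuated_matroid_def)
    let ?C = "B - {x}"
    have C: "?C \<subseteq> E" "Suc (card ?C) = r"
      using sB card_Suc_Diff1[OF fB x(1)] by auto
    have "cocircuit E p ?C x \<noteq> 0"
      using x sB B by (auto simp: cocircuit_def insert_absorb)
    then obtain b where b: "b \<in> D" "cocircuit E p ?C b \<noteq> 0"
      using \<open>meets_supports _ D\<close> cocircuit_in_trop_linear_space[OF fin C]
      unfolding meets_supports_def by blast
    then have "p (insert b ?C) \<noteq> 0" "b \<notin> ?C"
      by (auto simp: cocircuit_def split: if_splits)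
    moreover have "insert b ?C \<inter> D = insert b (B \<inter> D)" "b \<notin> B"
      using b x \<open>b \<notin> ?C\<close> by auto
    ultimately show False using mx[of "insert b ?C"] fB by simp
  qed
  then show ?thesis using B by blast
qed

lemma bases_eq_minimal_meeting_sets:
  assumes p: "valuated_matroid E r p"
  shows "{B. p B \<noteq> 0} =
    {B. meets_supports (trop_linear_space E r p) B \<and>
        (\<forall>B'. B' \<subset> B \<longrightarrow> \<not> meets_supports (trop_linear_space E r p) B')}"
proof (intro set_eqI iffI; clarsimp)
  fix B assume B: "p B \<noteq> 0"
  have "\<not> meets_supports (trop_linear_space E r p) B'" if "B' \<subset> B" for B'
  proof
    assume "meets_supports (trop_linear_space E r p) B'"
    then obtain B'' where "B'' \<subseteq> B'" "p B'' \<noteq> 0"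
      using meets_supports_contains_basis[OF p] by blast
    moreover have "finite B"
      using B p finite_subset by (auto simp: valuated_matroid_def)
    ultimately have "card B'' < card B"
      using that by (intro psubset_card_mono) auto
    moreover have "card B'' = r" "card B = r"
      using p B \<open>p B'' \<noteq> 0\<close> unfolding valuated_matroid_def by blast+
    ultimately show False by simp
  qed
  then show "meets_supports (trop_linear_space E r p) B \<and>
    (\<forall>B'\<subset>B. \<not> meets_supports (trop_linear_space E r p) B')"
    using basis_meets_supports[OF p B] by blast
next
  fix B assume m: "meets_supports (trop_linear_space E r p) B" and B0: "p B = 0"
    and min: "\<forall>B'\<subset>B. \<not> meets_supports (trop_linear_space E r p) B'"
  then obtain B' where "B' \<subseteq> B" "p B' \<noteq> 0"
    using meets_supports_contains_basis[OF p m] by auto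
  moreover have "meets_supports (trop_linear_space E r p) B'"
    using basis_meets_supports[OF p \<open>p B' \<noteq> 0\<close>] .
  moreover have "B' \<noteq> B" using B0 \<open>p B' \<noteq> 0\<close> by auto
  ultimately show False using min by blast
qed

lemma underlying_bases_eq:
  assumes p: "valuated_matroid E r p"
  shows "underlying_bases E (trop_linear_space E r p) = {B. p B \<noteq> 0}"
  unfolding underlying_bases_def
proof (rule the_equality)
  show "\<exists>r' p'. valuated_matroid E r' p' \<and>
      trop_linear_space E r p = trop_linear_space E r' p' \<and> {B. p B \<noteq> 0} = {B. p' B \<noteq> 0}"
    using p by blast
next
  fix \<B> assume "\<exists>r' p'. valuated_matroid E r' p' \<and>
      trop_linear_space E r p = trop_linear_space E r' p' \<and> \<B> = {B. p' B \<noteq> 0}"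
  then obtain r' p' where p': "valuated_matroid E r' p'"
    "trop_linear_space E r p = trop_linear_space E r' p'" "\<B> = {B. p' B \<noteq> 0}" by blast
  then show "\<B> = {B. p B \<noteq> 0}"
    using bases_eq_minimal_meeting_sets[OF p] bases_eq_minimal_meeting_sets[OF p'(1)] by simp
qed

lemma trop_rank_eq:
  assumes p: "valuated_matroid E r p"
  shows "trop_rank E (trop_linear_space E r p) = r"
  unfolding trop_rank_def
proof (rule the_equality)
  show "\<exists>p'. valuated_matroid E r p' \<and> trop_linear_space E r p = trop_linear_space E r p'"
    using p by blast
next
  fix r' assume "\<exists>p'. valuated_matroid E r' p' \<and>
      trop_linear_space E r p = trop_linear_space E r' p'"
  then obtain p' where p': "valuated_matroid E r' p'"
    "trop_linear_space E r p = trop_linear_space E r' p'" by blast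
  then have "{B. p B \<noteq> 0} = {B. p' B \<noteq> 0}"
    using bases_eq_minimal_meeting_sets[OF p] bases_eq_minimal_meeting_sets[OF p'(1)] by simp
  moreover obtain B where B: "p B \<noteq> 0" using p by (auto simp: valuated_matroid_def)
  ultimately have "p' B \<noteq> 0" by auto
  then have "card B = r'" using p'(1) by (auto simp: valuated_matroid_def)
  moreover have "card B = r" using B p by (auto simp: valuated_matroid_def)
  ultimately show "r' = r" by simp
qed


section \<open>Polynomials and tropical ideals\<close>

text \<open>
  Monomials are exponent vectors, and a polynomial in \<open>x\<^sub>0, \<dots>, x\<^sub>n\<close> is a finitely supported
  function on monomials that involve only the variables with index at most \<open>n\<close>.
\<close>

type_synonym monomial = "nat \<Rightarrow>\<^sub>0 nat"

type_synonym 's mpoly = "monomial \<Rightarrow>\<^sub>0 's"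

definition mono_deg :: "monomial \<Rightarrow> nat" where
  "mono_deg m = (\<Sum>i\<in>Poly_Mapping.keys m. Poly_Mapping.lookup m i)"

definition monomials :: "nat \<Rightarrow> nat \<Rightarrow> monomial set" where
  "monomials n d = {m. Poly_Mapping.keys m \<subseteq> {..n} \<and> mono_deg m = d}"

definition num_monomials :: "nat \<Rightarrow> int \<Rightarrow> nat" where
  "num_monomials n d = (if d < 0 then 0 else (n + nat d) choose (nat d))"

definition polys :: "nat \<Rightarrow> ('s::totally_ordered_idempotent_semifield) mpoly set" where
  "polys n = {f. \<forall>m\<in>Poly_Mapping.keys f. Poly_Mapping.keys m \<subseteq> {..n}}"

definition homogeneous_of_degree ::
    "nat \<Rightarrow> ('s::totally_ordered_idempotent_semifield) mpoly \<Rightarrow> bool" where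
  "homogeneous_of_degree d f \<longleftrightarrow> (\<forall>m\<in>Poly_Mapping.keys f. mono_deg m = d)"

definition homogeneous :: "('s::totally_ordered_idempotent_semifield) mpoly \<Rightarrow> bool" where
  "homogeneous f \<longleftrightarrow> (\<exists>d. homogeneous_of_degree d f)"

text \<open>Total degree, meaningful for \<open>f \<noteq> 0\<close> only.\<close>

definition poly_deg :: "('s::totally_ordered_idempotent_semifield) mpoly \<Rightarrow> nat" where
  "poly_deg f = Max (mono_deg ` Poly_Mapping.keys f)"

definition hom_component ::
    "nat \<Rightarrow> ('s::totally_ordered_idempotent_semifield) mpoly \<Rightarrow> 's mpoly" where
  "hom_component d f =
     (\<Sum>m | m \<in> Poly_Mapping.keys f \<and> mono_deg m = d.
        Poly_Mapping.single m (Poly_Mapping.lookup f m))"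

definition is_ideal :: "nat \<Rightarrow> ('s::totally_ordered_idempotent_semifield) mpoly set \<Rightarrow> bool" where
  "is_ideal n J \<longleftrightarrow>
     J \<subseteq> polys n \<and> 0 \<in> J \<and> (\<forall>f\<in>J. \<forall>g\<in>J. f + g \<in> J) \<and> (\<forall>q\<in>polys n. \<forall>f\<in>J. q * f \<in> J)"

definition is_homogeneous_ideal ::
    "nat \<Rightarrow> ('s::totally_ordered_idempotent_semifield) mpoly set \<Rightarrow> bool" where
  "is_homogeneous_ideal n J \<longleftrightarrow> is_ideal n J \<and> (\<forall>f\<in>J. \<forall>d. hom_component d f \<in> J)"

text \<open>The degree \<open>d\<close> part, as a set of vectors indexed by the monomials of degree \<open>d\<close>.\<close>

definition graded_part ::
    "('s::totally_ordered_idempotent_semifield) mpoly set \<Rightarrow> nat \<Rightarrow> (monomial \<Rightarrow> 's) set" where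
  "graded_part J d = Poly_Mapping.lookup ` {f\<in>J. homogeneous_of_degree d f}"

definition tropical_ideal ::
    "nat \<Rightarrow> ('s::totally_ordered_idempotent_semifield) mpoly set \<Rightarrow> bool" where
  "tropical_ideal n J \<longleftrightarrow>
     is_homogeneous_ideal n J \<and>
     (\<forall>d. is_trop_linear_space (monomials n d) (graded_part J d))"

definition hilbert_function ::
    "nat \<Rightarrow> ('s::totally_ordered_idempotent_semifield) mpoly set \<Rightarrow> nat \<Rightarrow> int" where
  "hilbert_function n J d =
     int (num_monomials n (int d)) - int (trop_rank (monomials n d) (graded_part J d))"

definition numerically_principal ::
    "nat \<Rightarrow> nat \<Rightarrow> ('s::totally_ordered_idempotent_semifield) mpoly set \<Rightarrow> bool" where
  "numerically_principal n D J \<longleftrightarrow>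
     tropical_ideal n J \<and>
     (\<forall>d. hilbert_function n J d =
        int (num_monomials n (int d)) - int (num_monomials n (int d - int D)))"


section \<open>The Macaulay tropical ideal\<close>

definition macaulay_matrix ::
    "('s::totally_ordered_idempotent_semifield) mpoly \<Rightarrow> monomial \<Rightarrow> monomial \<Rightarrow> 's" where
  "macaulay_matrix f X Y = Poly_Mapping.lookup (Poly_Mapping.single X 1 * f) Y"

text \<open>The tropical maximal minors of the degree \<open>d\<close> Macaulay matrix, for \<open>d \<ge> poly_deg f\<close>.\<close>

definition macaulay_minor ::
    "nat \<Rightarrow> ('s::totally_ordered_idempotent_semifield) mpoly \<Rightarrow> nat \<Rightarrow> monomial set \<Rightarrow> 's" where
  "macaulay_minor n f d B =
     (let R = monomials n (d - poly_deg f) in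
      if B \<subseteq> monomials n d \<and> card B = card R
      then Max {\<Prod>X\<in>R. macaulay_matrix f X (\<sigma> X) | \<sigma>. bij_betw \<sigma> R B}
      else 0)"

text \<open>The degree \<open>d\<close> part of the Macaulay tropical ideal of \<open>f\<close>.\<close>

definition macaulay_part ::
    "nat \<Rightarrow> ('s::totally_ordered_idempotent_semifield) mpoly \<Rightarrow> nat \<Rightarrow> (monomial \<Rightarrow> 's) set" where
  "macaulay_part n f d =
     (if d < poly_deg f then {\<lambda>_. 0}
      else trop_linear_space (monomials n d)
             (num_monomials n (int d - int (poly_deg f))) (macaulay_minor n f d))"

end

theory Submission
  imports Defs "HOL-Library.FuncSet"
begin

text \<open>
  Fix \<open>d \<ge> D = deg f\<close>, let \<open>R\<close> be the set of monomials of degree \<open>d - D\<close>, and let \<open>B\<close> be a basis of the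
  underlying matroid of \<open>I\<^sub>d\<close>.  Numerical principality says \<open>|B| = |R|\<close>.  The claim is that \<open>B\<close> is already
  a basis for \<open>[f]\<^sub>d\<close>, that is, that the tropical minor on the columns \<open>B\<close> is nonzero.  As the semifield
  has no zero divisors and addition is maximum, no cancellation can occur, and this minor is nonzero
  exactly when the monomials \<open>X \<in> R\<close> can be matched bijectively with elements of \<open>B\<close> lying in
  the supports of the rows \<open>Xf\<close>.

  By Hall's theorem a matching exists as soon as, for every \<open>S \<subseteq> R\<close>, the supports of the \<open>Xf\<close> with
  \<open>X \<in> S\<close> together contain at least \<open>|S|\<close> elements of \<open>B\<close>.  Write \<open>W\<close> for the union of these
  supports.  All the vectors \<open>Xf\<close> lie in the ideal, and for a monomial order their leading monomials
  are \<open>X\<close> times that of \<open>f\<close>, hence pairwise distinct.  The complement of the support of a vector in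
  a tropical linear space is a flat of its matroid.  So, starting from the independent set \<open>B - W\<close>,
  the leading monomials can be added one at a time in decreasing order: \<open>Xf\<close> vanishes on everything
  collected before its leading monomial, so this monomial lies outside a flat that contains the
  collected set, and adding it preserves independence
  (\<open>independent_insert\<close>, \<open>independent_Un_leading_positions\<close>).  The result has
  \<open>|B - W| + |S|\<close> elements and is independent, so this number is at most \<open>|B|\<close>, which is Hall's
  condition (\<open>card_leading_positions_le\<close>, \<open>trop_minor_of_leading_positions\<close>).

  The bases of \<open>[f]\<^sub>d\<close> can be read off its minors only because these minors form a valuated matroid.
  Their tropical Pluecker relations come from exchanging two optimal matchings along an alternating
  path (\<open>alternating_path_exchange\<close>, \<open>valuated_matroid_trop_minor\<close>).  For \<open>d < D\<close> both matroids have
  rank \<open>0\<close>.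
\<close>


section \<open>Systems of distinct representatives\<close>

text \<open>
  The induction of Halmos and Vaughan.  If every nonempty proper subfamily has a spare element, any
  choice for one index leaves Hall's condition intact for the others; otherwise some proper subfamily
  exactly fills its union, and it can be split off.
\<close>

lemma hall_marriage:
  assumes "finite R" and "\<And>x. x \<in> R \<Longrightarrow> finite (N x)"
    and "\<And>S. S \<subseteq> R \<Longrightarrow> card S \<le> card (\<Union>(N ` S))"
  shows "\<exists>\<sigma>. inj_on \<sigma> R \<and> (\<forall>x\<in>R. \<sigma> x \<in> N x)"
  using assms
proof (induction R arbitrary: N rule: finite_psubset_induct)
  case (psubset R)
  note fin = psubset.prems(1) and hall = psubset.prems(2)
  have finU: "finite (\<Union>(N ` S))" if "S \<subseteq> R" for S
    using that fin psubset.hyps finite_subset by blast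
  consider "R = {}"
    | (slack) "R \<noteq> {}" "\<And>S. S \<noteq> {} \<Longrightarrow> S \<subset> R \<Longrightarrow> card S < card (\<Union>(N ` S))"
    | (tight) S where "S \<noteq> {}" "S \<subset> R" "card (\<Union>(N ` S)) \<le> card S"
    by (meson not_le)
  then show ?case
  proof cases
    case 1
    then show ?thesis by simp
  next
    case slack
    then obtain x where x: "x \<in> R" by blast
    \<comment> \<open>The one element removed from all the other sets is paid for by the slack.\<close>
    have "card {x} \<le> card (\<Union>(N ` {x}))" using x by (intro hall) auto
    then obtain y where y: "y \<in> N x" by (cases "N x = {}") auto
    have "\<exists>\<sigma>. inj_on \<sigma> (R - {x}) \<and> (\<forall>z\<in>R - {x}. \<sigma> z \<in> N z - {y})"
    proof (rule psubset.IH)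
      show "R - {x} \<subset> R" using x by blast
      show "finite (N z - {y})" if "z \<in> R - {x}" for z using that fin by auto
      show "card S \<le> card (\<Union>z\<in>S. N z - {y})" if S: "S \<subseteq> R - {x}" for S
      proof (cases "S = {}")
        case False
        have "card S < card (\<Union>(N ` S))" using False S x by (intro slack) auto
        moreover have "(\<Union>z\<in>S. N z - {y}) = \<Union>(N ` S) - {y}" by auto
        ultimately show ?thesis
          using card_Diff1_le card_Diff_singleton_if[of "\<Union>(N ` S)" y] by auto
      qed simp
    qed
    then obtain \<sigma> where \<sigma>: "inj_on \<sigma> (R - {x})" "\<forall>z\<in>R - {x}. \<sigma> z \<in> N z - {y}" by blast
    have "inj_on (\<sigma>(x := y)) R"
      using \<sigma> by (auto simp: inj_on_def)
    moreover have "\<forall>z\<in>R. (\<sigma>(x := y)) z \<in> N z" using \<sigma> y by auto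
    ultimately show ?thesis by blast
  next
    case tight
    let ?NS = "\<Union>(N ` S)"
    have "\<exists>\<sigma>. inj_on \<sigma> S \<and> (\<forall>z\<in>S. \<sigma> z \<in> N z)"
    proof (rule psubset.IH[OF tight(2)])
      show "finite (N z)" if "z \<in> S" for z using that fin tight(2) by auto
      show "card T \<le> card (\<Union>(N ` T))" if "T \<subseteq> S" for T using that tight(2) by (intro hall) auto
    qed
    then obtain \<sigma> where \<sigma>: "inj_on \<sigma> S" "\<forall>z\<in>S. \<sigma> z \<in> N z" by blast
    have "\<exists>\<tau>. inj_on \<tau> (R - S) \<and> (\<forall>z\<in>R - S. \<tau> z \<in> N z - ?NS)"
    proof (rule psubset.IH)
      show "R - S \<subset> R" using tight by blast
      show "finite (N z - ?NS)" if "z \<in> R - S" for z using that fin by auto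
      show "card T \<le> card (\<Union>z\<in>T. N z - ?NS)" if T: "T \<subseteq> R - S" for T
      proof -
        \<comment> \<open>Hall's condition for \<open>S \<union> T\<close>, less the at most \<open>card S\<close> elements used for \<open>S\<close>.\<close>
        have eq: "(\<Union>z\<in>T. N z - ?NS) = \<Union>(N ` (S \<union> T)) - ?NS" by auto
        have "card (\<Union>(N ` (S \<union> T)) - ?NS) = card (\<Union>(N ` (S \<union> T))) - card ?NS"
          using finU[of S] tight(2) by (intro card_Diff_subset) auto
        moreover have "card (S \<union> T) \<le> card (\<Union>(N ` (S \<union> T)))"
          using T tight(2) by (intro hall) auto
        moreover have "card (S \<union> T) = card S + card T"
          using T tight(2) psubset.hyps
          by (intro card_Un_disjoint) (auto intro: finite_subset)
        ultimately show ?thesis unfolding eq using tight(3) by linarith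
      qed
    qed
    then obtain \<tau> where \<tau>: "inj_on \<tau> (R - S)" "\<forall>z\<in>R - S. \<tau> z \<in> N z - ?NS" by blast
    let ?\<rho> = "\<lambda>z. if z \<in> S then \<sigma> z else \<tau> z"
    have sep: "\<sigma> a \<noteq> \<tau> b" if "a \<in> S" "b \<in> R - S" for a b
    proof -
      have "\<sigma> a \<in> ?NS" "\<tau> b \<notin> ?NS" using \<sigma>(2) \<tau>(2) that by blast+
      then show ?thesis by metis
    qed
    have "inj_on ?\<rho> R"
    proof (rule inj_onI)
      fix a b assume ab: "a \<in> R" "b \<in> R" "?\<rho> a = ?\<rho> b"
      then show "a = b"
        using inj_onD[OF \<sigma>(1)] inj_onD[OF \<tau>(1)] sep[of a b] sep[of b a]
        by (cases "a \<in> S"; cases "b \<in> S") auto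
    qed
    then show ?thesis using \<sigma> \<tau> by (intro exI[of _ ?\<rho>]) auto
  qed
qed


section \<open>Tropical maximal minors\<close>

text \<open>
  Rows are indexed by \<open>R\<close> and columns by \<open>E\<close>.  On column sets of size \<open>card R\<close> this is the tropical
  determinant, for which no ordering of rows and columns is needed as there are no signs.
\<close>

definition trop_minor ::
    "('x \<Rightarrow> 'e \<Rightarrow> 's::totally_ordered_idempotent_semifield) \<Rightarrow> 'x set \<Rightarrow> 'e set \<Rightarrow> 'e set \<Rightarrow> 's"
  where "trop_minor M R E B =
    (if B \<subseteq> E \<and> card B = card R then Max {\<Prod>x\<in>R. M x (\<sigma> x) | \<sigma>. bij_betw \<sigma> R B} else 0)"

lemma finite_matching_products:
  assumes "finite R" "finite B"
  shows "finite {\<Prod>x\<in>R. M x (\<sigma> x) | \<sigma>. bij_betw \<sigma> R B}"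
proof (rule finite_subset)
  show "{\<Prod>x\<in>R. M x (\<sigma> x) | \<sigma>. bij_betw \<sigma> R B} \<subseteq> (\<lambda>\<sigma>. \<Prod>x\<in>R. M x (\<sigma> x)) ` (R \<rightarrow>\<^sub>E B)"
  proof clarify
    fix \<sigma> assume "bij_betw \<sigma> R B"
    then have "restrict \<sigma> R \<in> R \<rightarrow>\<^sub>E B" by (auto simp: bij_betw_def)
    moreover have "(\<Prod>x\<in>R. M x (\<sigma> x)) = (\<Prod>x\<in>R. M x (restrict \<sigma> R x))" by simp
    ultimately show "(\<Prod>x\<in>R. M x (\<sigma> x)) \<in> (\<lambda>\<sigma>. \<Prod>x\<in>R. M x (\<sigma> x)) ` (R \<rightarrow>\<^sub>E B)" by blast
  qed
  show "finite ((\<lambda>\<sigma>. \<Prod>x\<in>R. M x (\<sigma> x)) ` (R \<rightarrow>\<^sub>E B))"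
    using assms by (intro finite_imageI finite_PiE)
qed

lemma matching_le_trop_minor:
  assumes "finite R" "finite E" "B \<subseteq> E" "bij_betw \<sigma> R B"
  shows "(\<Prod>x\<in>R. M x (\<sigma> x)) \<le> trop_minor M R E B"
proof -
  have "card B = card R" using assms(4) by (simp add: bij_betw_same_card)
  moreover have "finite B" using assms finite_subset by blast
  ultimately show ?thesis
    using assms finite_matching_products[of R B M]
    by (auto simp: trop_minor_def intro!: Max_ge)
qed

lemma trop_minor_attained:
  assumes "finite R" "finite E" "B \<subseteq> E" "card B = card R"
  obtains \<sigma> where "bij_betw \<sigma> R B" "trop_minor M R E B = (\<Prod>x\<in>R. M x (\<sigma> x))"
proof -
  let ?P = "{\<Prod>x\<in>R. M x (\<sigma> x) | \<sigma>. bij_betw \<sigma> R B}"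
  have fB: "finite B" using assms finite_subset by blast
  obtain \<sigma> where "bij_betw \<sigma> R B"
    using finite_same_card_bij[OF assms(1) fB] assms(4) by auto
  then have "?P \<noteq> {}" by blast
  then have "Max ?P \<in> ?P" using finite_matching_products[OF assms(1) fB] by (intro Max_in)
  then show ?thesis using that assms(3,4) unfolding trop_minor_def by auto
qed

lemma prod_eq_0_iff_ex:
  fixes g :: "'b \<Rightarrow> 's::totally_ordered_idempotent_semifield"
  assumes "finite A"
  shows "prod g A = 0 \<longleftrightarrow> (\<exists>x\<in>A. g x = 0)"
  using assms by (induction A) (auto simp: mult_eq_0_iff_either)

lemma trop_minor_neq_0_iff:
  assumes "finite R" "finite E" "B \<subseteq> E"
  shows "trop_minor M R E B \<noteq> 0 \<longleftrightarrow> (\<exists>\<sigma>. bij_betw \<sigma> R B \<and> (\<forall>x\<in>R. M x (\<sigma> x) \<noteq> 0))"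
proof
  assume nz: "trop_minor M R E B \<noteq> 0"
  then have "card B = card R" by (auto simp: trop_minor_def split: if_splits)
  then obtain \<sigma> where "bij_betw \<sigma> R B" "trop_minor M R E B = (\<Prod>x\<in>R. M x (\<sigma> x))"
    using trop_minor_attained[OF assms] by blast
  then show "\<exists>\<sigma>. bij_betw \<sigma> R B \<and> (\<forall>x\<in>R. M x (\<sigma> x) \<noteq> 0)"
    using nz prod_eq_0_iff_ex[OF assms(1)] by metis
next
  assume "\<exists>\<sigma>. bij_betw \<sigma> R B \<and> (\<forall>x\<in>R. M x (\<sigma> x) \<noteq> 0)"
  then obtain \<sigma> where \<sigma>: "bij_betw \<sigma> R B" "\<forall>x\<in>R. M x (\<sigma> x) \<noteq> 0" by blast
  then have "(\<Prod>x\<in>R. M x (\<sigma> x)) \<noteq> 0" by (simp add: prod_eq_0_iff_ex[OF assms(1)])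
  then show "trop_minor M R E B \<noteq> 0"
    using matching_le_trop_minor[OF assms \<sigma>(1), of M] zero_least by (metis order.antisym)
qed

text \<open>
  Start at the row \<open>x\<close> with \<open>\<tau> x = i\<close> and move to \<open>\<sigma> x\<close>; if this is again a value of \<open>\<tau>\<close>, continue from
  the row where it is taken.  The path never returns, because \<open>i\<close> is not a value of \<open>\<sigma>\<close>, so it ends at
  a value \<open>j\<close> of \<open>\<sigma>\<close> that is not one of \<open>\<tau>\<close>.  Exchanging \<open>\<sigma>\<close> and \<open>\<tau>\<close> on the rows \<open>P\<close> of the path moves
  \<open>i\<close> from the image of \<open>\<tau>\<close> to that of \<open>\<sigma>\<close> and \<open>j\<close> in the other direction.
\<close>

lemma alternating_path_exchange:
  assumes "finite R" "inj_on \<sigma> R" "inj_on \<tau> R" "i \<in> \<tau> ` R" "i \<notin> \<sigma> ` R"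
  shows "\<exists>P\<subseteq>R. \<exists>j\<in>\<sigma> ` R - \<tau> ` R.
    (\<lambda>x. if x \<in> P then \<tau> x else \<sigma> x) ` R = insert i (\<sigma> ` R - {j}) \<and>
    (\<lambda>x. if x \<in> P then \<sigma> x else \<tau> x) ` R = insert j (\<tau> ` R - {i})"
  using assms
proof (induction R arbitrary: i rule: finite_psubset_induct)
  case (psubset R)
  obtain x where x: "x \<in> R" "\<tau> x = i" using psubset.prems by blast
  let ?R = "R - {x}"
  have im: "\<sigma> ` ?R = \<sigma> ` R - {\<sigma> x}" "\<tau> ` ?R = \<tau> ` R - {i}"
    using x psubset.prems by (auto simp: inj_on_def)
  have R: "R = insert x ?R" using x by blast
  \<comment> \<open>Deleting the first row of the path leaves a shorter one, which starts at \<open>\<sigma> x\<close>.\<close>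
  show ?case
  proof (cases "\<sigma> x \<in> \<tau> ` R")
    case False
    have "(\<lambda>z. if z \<in> {x} then \<tau> z else \<sigma> z) ` R = insert i (\<sigma> ` ?R)"
      "(\<lambda>z. if z \<in> {x} then \<sigma> z else \<tau> z) ` R = insert (\<sigma> x) (\<tau> ` ?R)"
      using x by auto
    then show ?thesis using False x(1) unfolding im by (intro exI[of _ "{x}"]) blast
  next
    case True
    have "\<sigma> x \<noteq> i" using psubset.prems x by blast
    then have "\<sigma> x \<in> \<tau> ` ?R" "\<sigma> x \<notin> \<sigma> ` ?R" using True im by auto
    moreover have "?R \<subset> R" "inj_on \<sigma> ?R" "inj_on \<tau> ?R"
      using x psubset.prems by (auto intro: inj_on_subset)
    ultimately obtain P j where P: "P \<subseteq> ?R" and j: "j \<in> \<sigma> ` ?R - \<tau> ` ?R"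
      and e1: "(\<lambda>x. if x \<in> P then \<tau> x else \<sigma> x) ` ?R = insert (\<sigma> x) (\<sigma> ` ?R - {j})"
      and e2: "(\<lambda>x. if x \<in> P then \<sigma> x else \<tau> x) ` ?R = insert j (\<tau> ` ?R - {\<sigma> x})"
      using psubset.IH[of ?R "\<sigma> x"] by blast
    let ?P = "insert x P"
    have "(\<lambda>z. if z \<in> ?P then \<tau> z else \<sigma> z) ` R
        = insert i ((\<lambda>z. if z \<in> P then \<tau> z else \<sigma> z) ` ?R)"
      using x by (subst R) auto
    also have "\<dots> = insert i (\<sigma> ` R - {j})" unfolding e1 im using j im x by auto
    finally have f1: "(\<lambda>z. if z \<in> ?P then \<tau> z else \<sigma> z) ` R = insert i (\<sigma> ` R - {j})" .
    have "(\<lambda>z. if z \<in> ?P then \<sigma> z else \<tau> z) ` R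
        = insert (\<sigma> x) ((\<lambda>z. if z \<in> P then \<sigma> z else \<tau> z) ` ?R)"
      by (subst R) auto
    also have "\<dots> = insert j (\<tau> ` R - {i})"
      unfolding e2 im using True \<open>\<sigma> x \<noteq> i\<close> by auto
    finally have f2: "(\<lambda>z. if z \<in> ?P then \<sigma> z else \<tau> z) ` R = insert j (\<tau> ` R - {i})" .
    have "j \<in> \<sigma> ` R" "j \<notin> \<tau> ` R - {i}" using j unfolding im by blast+
    moreover from this(1) have "j \<noteq> i" using psubset.prems(4) by blast
    ultimately have "j \<in> \<sigma> ` R - \<tau> ` R" by blast
    moreover have "?P \<subseteq> R" using P x(1) by blast
    ultimately show ?thesis using f1 f2 by blast
  qed
qed

lemma tropically_vanishes_if_dominated:
  assumes "finite A" and dom: "\<And>i. i \<in> A \<Longrightarrow> g i \<noteq> 0 \<Longrightarrow> \<exists>j\<in>A - {i}. g i \<le> g j"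
  shows "tropically_vanishes g A"
  unfolding tropically_vanishes_def
proof
  fix i assume i: "i \<in> A"
  have split: "sum g A = max (g i) (sum g (A - {i}))"
    using sum.remove[OF assms(1) i, of g] by (simp add: add_eq_max)
  have "g i \<le> sum g (A - {i})"
  proof (cases "g i = 0")
    case False
    then obtain j where j: "j \<in> A - {i}" "g i \<le> g j" using dom i by blast
    have "sum g (A - {i}) = max (g j) (sum g (A - {i} - {j}))"
      using sum.remove[OF _ j(1), of g] assms(1) by (simp add: add_eq_max)
    then show ?thesis using j(2) by (simp add: le_max_iff_disj)
  qed (simp add: zero_least)
  then show "sum g (A - {i}) = sum g A" using split by (simp add: max_absorb2)
qed

lemma idem_mult_mono:
  fixes a b c d :: "'s::totally_ordered_idempotent_semifield"
  assumes "a \<le> b" "c \<le> d"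
  shows "a * c \<le> b * d"
  by (metis assms idem_mult_left_mono mult.commute order.trans)

text \<open>
  Let a term of a Pluecker relation be given by optimal matchings \<open>\<sigma>\<close> of \<open>A - {i}\<close> and \<open>\<tau>\<close> of
  \<open>insert i B\<close>.  Exchanging them along the alternating path from \<open>i\<close> yields matchings that contribute
  to the term of another index \<open>j\<close>.  The same matrix entries are used in total, so the term of \<open>j\<close> is
  at least as large, and dropping the term of \<open>i\<close> does not change the maximum.
\<close>

lemma valuated_matroid_trop_minor:
  fixes M :: "'x \<Rightarrow> 'e \<Rightarrow> 's::totally_ordered_idempotent_semifield"
  assumes R: "finite R" and E: "finite E" and ne: "\<exists>B. trop_minor M R E B \<noteq> 0"
  shows "valuated_matroid E (card R) (trop_minor M R E)"
  unfolding valuated_matroid_def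
proof (intro conjI allI impI)
  let ?p = "trop_minor M R E"
  fix A B assume AB: "A \<subseteq> E \<and> card A = Suc (card R) \<and> B \<subseteq> E \<and> Suc (card B) = card R"
  have fA: "finite A" "finite B" using AB E finite_subset by auto
  show "tropically_vanishes (\<lambda>i. ?p (A - {i}) * ?p (insert i B)) (A - B)"
  proof (rule tropically_vanishes_if_dominated)
    fix i assume i: "i \<in> A - B"
    have "A - {i} \<subseteq> E" "card (A - {i}) = card R" using AB i fA by auto
    then obtain \<sigma> where \<sigma>: "bij_betw \<sigma> R (A - {i})" "?p (A - {i}) = (\<Prod>x\<in>R. M x (\<sigma> x))"
      using trop_minor_attained[OF R E] by blast
    have "insert i B \<subseteq> E" "card (insert i B) = card R" using AB i fA by auto
    then obtain \<tau> where \<tau>: "bij_betw \<tau> R (insert i B)" "?p (insert i B) = (\<Prod>x\<in>R. M x (\<tau> x))"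
      using trop_minor_attained[OF R E] by blast
    have im: "\<sigma> ` R = A - {i}" "\<tau> ` R = insert i B" using \<sigma> \<tau> by (auto simp: bij_betw_def)
    have "inj_on \<sigma> R" "inj_on \<tau> R" "i \<in> \<tau> ` R" "i \<notin> \<sigma> ` R"
      using \<sigma> \<tau> im by (auto simp: bij_betw_def)
    from alternating_path_exchange[OF R this] obtain P j where j: "j \<in> (A - {i}) - insert i B"
      and e1: "(\<lambda>x. if x \<in> P then \<tau> x else \<sigma> x) ` R = insert i (A - {i} - {j})"
      and e2: "(\<lambda>x. if x \<in> P then \<sigma> x else \<tau> x) ` R = insert j (insert i B - {i})"
      unfolding im by blast
    let ?\<sigma> = "\<lambda>x. if x \<in> P then \<tau> x else \<sigma> x" and ?\<tau> = "\<lambda>x. if x \<in> P then \<sigma> x else \<tau> x"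
    have e1': "?\<sigma> ` R = A - {j}" and e2': "?\<tau> ` R = insert j B" using e1 e2 i j by auto
    have "card (A - {j}) = card R" "card (insert j B) = card R" using AB fA j by auto
    then have b: "bij_betw ?\<sigma> R (A - {j})" "bij_betw ?\<tau> R (insert j B)"
      unfolding bij_betw_def using e1' e2' R by (auto intro!: eq_card_imp_inj_on)
    have "?p (A - {i}) * ?p (insert i B) = (\<Prod>x\<in>R. M x (\<sigma> x) * M x (\<tau> x))"
      by (simp add: \<sigma> \<tau> prod.distrib)
    also have "\<dots> = (\<Prod>x\<in>R. M x (?\<sigma> x) * M x (?\<tau> x))"
      by (rule prod.cong) (auto simp: mult.commute)
    also have "\<dots> = (\<Prod>x\<in>R. M x (?\<sigma> x)) * (\<Prod>x\<in>R. M x (?\<tau> x))"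
      by (simp only: prod.distrib)
    also have "\<dots> \<le> ?p (A - {j}) * ?p (insert j B)"
      using AB j by (intro idem_mult_mono matching_le_trop_minor[OF R E] b) auto
    finally show "\<exists>j\<in>A - B - {i}. ?p (A - {i}) * ?p (insert i B) \<le> ?p (A - {j}) * ?p (insert j B)"
      using j by blast
  qed (use fA in simp)
qed (use assms in \<open>auto simp: trop_minor_def split: if_splits\<close>)


section \<open>Vectors with distinct leading positions\<close>

text \<open>
  The zero set of a vector in a tropical linear space is a flat.  Since terms cannot cancel, a vector
  that vanishes on \<open>J\<close> but not at \<open>m\<close> involves a cocircuit with the same property, and one basis
  exchange with the basis witnessing this cocircuit brings \<open>m\<close> into a basis around \<open>J\<close>.
\<close>

lemma independent_insert:
  assumes p: "valuated_matroid E r p" and v: "v \<in> trop_linear_space E r p"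
    and J: "indep_in {B. p B \<noteq> 0} J" and vJ: "\<And>j. j \<in> J \<Longrightarrow> v j = 0" and m: "v m \<noteq> 0"
  shows "indep_in {B. p B \<noteq> 0} (insert m J)"
proof -
  let ?S = "{C. C \<subseteq> E \<and> Suc (card C) = r}"
  have fs: "finite ?S" using p by (auto simp: valuated_matroid_def)
  obtain c where c: "v = (\<lambda>i. \<Sum>C\<in>?S. c C * cocircuit E p C i)"
    using v unfolding trop_linear_space_def by auto
  obtain C where C: "C \<in> ?S" "c C * cocircuit E p C m \<noteq> 0"
    using m unfolding c by (meson sum.neutral)
  have CJ: "cocircuit E p C j = 0" if "j \<in> J" for j
  proof -
    have "(\<Sum>C\<in>?S. c C * cocircuit E p C j) = 0" using vJ[OF that] unfolding c .
    then have "\<forall>C\<in>?S. c C * cocircuit E p C j = 0" by (rule sum_eq_0_iff_all[OF fs, THEN iffD1])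
    then have "c C * cocircuit E p C j = 0" using C(1) by (rule bspec)
    moreover have "c C \<noteq> 0" using C(2) by auto
    ultimately show ?thesis by (simp add: mult_eq_0_iff_either)
  qed
  have m': "m \<in> E - C" "p (insert m C) \<noteq> 0"
    using C(2) by (auto simp: cocircuit_def split: if_splits)
  obtain B where B: "p B \<noteq> 0" "J \<subseteq> B" using J by (auto simp: indep_in_def)
  show ?thesis
  proof (cases "m \<in> B")
    case True
    then show ?thesis using B by (auto simp: indep_in_def)
  next
    case False
    then obtain y where y: "y \<in> B - insert m C" "p (insert y (insert m C - {m})) \<noteq> 0"
      "p (insert m (B - {y})) \<noteq> 0"
      using valuated_matroid_exchange[OF p m'(2) B(1), of m] by blast
    have "insert m C - {m} = C" "B \<subseteq> E" using m' p B by (auto simp: valuated_matroid_def)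
    then have "cocircuit E p C y \<noteq> 0" using y by (auto simp: cocircuit_def)
    \<comment> \<open>The element given up in exchange for \<open>m\<close> lies in the support of the cocircuit, so not in \<open>J\<close>.\<close>
    then have "y \<notin> J" using CJ by blast
    then have "insert m J \<subseteq> insert m (B - {y})" using B(2) by blast
    then show ?thesis unfolding indep_in_def by (rule bexI) (simp add: y(3))
  qed
qed

text \<open>
  Adding the positions of \<open>T\<close> in decreasing order, the vector led by \<open>t\<close> vanishes on all that are
  already there.
\<close>

lemma independent_Un_leading_positions:
  fixes T :: "'e::linorder set"
  assumes p: "valuated_matroid E r p" and J: "indep_in {B. p B \<noteq> 0} J" and "finite T"
    and "\<forall>t\<in>T. \<exists>v\<in>trop_linear_space E r p. v t \<noteq> 0 \<and> (\<forall>e>t. v e = 0) \<and> (\<forall>j\<in>J. v j = 0)"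
  shows "indep_in {B. p B \<noteq> 0} (J \<union> T)"
  using assms(3,4)
proof (induction T rule: finite_linorder_min_induct)
  case (insert t T)
  then obtain v where v: "v \<in> trop_linear_space E r p" "v t \<noteq> 0" "\<forall>e>t. v e = 0" "\<forall>j\<in>J. v j = 0"
    by auto
  have "indep_in {B. p B \<noteq> 0} (insert t (J \<union> T))"
    using insert v by (intro independent_insert[OF p v(1)]) auto
  then show ?case by simp
qed (use J in simp)

text \<open>
  The tropical counterpart of the fact that vectors with distinct leading positions and supports in
  \<open>W\<close> are linearly independent and stay so when restricted to \<open>B \<inter> W\<close>.
\<close>

lemma card_leading_positions_le:
  fixes T :: "'e::linorder set"
  assumes p: "valuated_matroid E r p" and B: "p B \<noteq> 0" and T: "finite T"
    and v: "\<forall>t\<in>T. \<exists>v\<in>trop_linear_space E r p. v t \<noteq> 0 \<and> (\<forall>e>t. v e = 0) \<and> (\<forall>e. v e \<noteq> 0 \<longrightarrow> e \<in> W)"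
  shows "card T \<le> card (B \<inter> W)"
proof -
  have fE: "finite E" and BE: "B \<subseteq> E" "card B = r"
    using p B unfolding valuated_matroid_def by blast+
  have fB: "finite B" using fE BE finite_subset by blast
  have "indep_in {B. p B \<noteq> 0} (B - W)" using B by (auto simp: indep_in_def)
  then have "indep_in {B. p B \<noteq> 0} ((B - W) \<union> T)"
    using v by (intro independent_Un_leading_positions[OF p _ T]) blast+
  then obtain B' where B': "p B' \<noteq> 0" "(B - W) \<union> T \<subseteq> B'" by (auto simp: indep_in_def)
  have "B' \<subseteq> E" "card B' = r" using p B'(1) unfolding valuated_matroid_def by blast+
  moreover from this(1) have "finite B'" using fE by (rule finite_subset)
  ultimately have "card ((B - W) \<union> T) \<le> card B" using B'(2) BE(2) card_mono by metis
  moreover have "card ((B - W) \<union> T) = card (B - W) + card T"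
    using fB T v by (intro card_Un_disjoint) auto
  moreover have "card B = card (B - W) + card (B \<inter> W)"
    using fB by (metis add.commute card_Int_Diff)
  ultimately show ?thesis by simp
qed

lemma trop_minor_of_leading_positions:
  fixes M :: "'x \<Rightarrow> 'e::linorder \<Rightarrow> 's::totally_ordered_idempotent_semifield"
  assumes p: "valuated_matroid E (card R) p" and B: "p B \<noteq> 0" and R: "finite R"
    and rows: "\<And>x. x \<in> R \<Longrightarrow> M x \<in> trop_linear_space E (card R) p"
    and lead: "inj_on l R" "\<And>x. x \<in> R \<Longrightarrow> M x (l x) \<noteq> 0" "\<And>x e. x \<in> R \<Longrightarrow> l x < e \<Longrightarrow> M x e = 0"
  shows "trop_minor M R E B \<noteq> 0"
proof -
  have fE: "finite E" and BE: "B \<subseteq> E" "card B = card R"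
    using p B unfolding valuated_matroid_def by blast+
  have fB: "finite B" using fE BE finite_subset by blast
  have "\<exists>\<sigma>. inj_on \<sigma> R \<and> (\<forall>x\<in>R. \<sigma> x \<in> {b\<in>B. M x b \<noteq> 0})"
  proof (rule hall_marriage[OF R])
    fix S assume S: "S \<subseteq> R"
    let ?W = "{e. \<exists>x\<in>S. M x e \<noteq> 0}"
    have "card (l ` S) \<le> card (B \<inter> ?W)"
    proof (rule card_leading_positions_le[OF p B])
      show "finite (l ` S)" using S R finite_subset by blast
      show "\<forall>t\<in>l ` S. \<exists>v\<in>trop_linear_space E (card R) p.
          v t \<noteq> 0 \<and> (\<forall>e>t. v e = 0) \<and> (\<forall>e. v e \<noteq> 0 \<longrightarrow> e \<in> ?W)"
      proof
        fix t assume "t \<in> l ` S"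
        then obtain x where "x \<in> S" "t = l x" by blast
        then show "\<exists>v\<in>trop_linear_space E (card R) p.
            v t \<noteq> 0 \<and> (\<forall>e>t. v e = 0) \<and> (\<forall>e. v e \<noteq> 0 \<longrightarrow> e \<in> ?W)"
          using S rows lead by (intro bexI[of _ "M x"]) auto
      qed
    qed
    moreover have "card (l ` S) = card S" using S lead(1) by (meson card_image inj_on_subset)
    moreover have "B \<inter> ?W = (\<Union>x\<in>S. {b\<in>B. M x b \<noteq> 0})" by auto
    ultimately show "card S \<le> card (\<Union>x\<in>S. {b\<in>B. M x b \<noteq> 0})" by simp
  qed (use fB in simp)
  then obtain \<sigma> where \<sigma>: "inj_on \<sigma> R" "\<forall>x\<in>R. \<sigma> x \<in> {b\<in>B. M x b \<noteq> 0}" by blast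
  then have "\<sigma> ` R = B" using fB BE by (intro card_subset_eq) (auto simp: card_image)
  then show ?thesis
    using \<sigma> trop_minor_neq_0_iff[OF R fE BE(1)] unfolding bij_betw_def by blast
qed


section \<open>Monomials and their multiples of a polynomial\<close>

lemma mono_deg_eq_sum:
  assumes "finite A" "Poly_Mapping.keys m \<subseteq> A"
  shows "mono_deg m = (\<Sum>i\<in>A. Poly_Mapping.lookup m i)"
  unfolding mono_deg_def using assms by (intro sum.mono_neutral_left) (auto simp: in_keys_iff)

lemma mono_deg_add: "mono_deg (a + b) = mono_deg a + mono_deg b"
proof -
  let ?K = "Poly_Mapping.keys a \<union> Poly_Mapping.keys b"
  have "Poly_Mapping.keys (a + b) \<subseteq> ?K" by (rule keys_add)
  then show ?thesis
    by (simp add: mono_deg_eq_sum[of ?K] lookup_add sum.distrib)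
qed

text \<open>
  Exponent vectors as lists: this turns the number of monomials into the count of weak compositions
  (stars and bars).
\<close>

lemma bij_betw_monomials_lists:
  "bij_betw (\<lambda>m. map (Poly_Mapping.lookup m) [0..<Suc n]) (monomials n d)
     {l. length l = Suc n \<and> sum_list l = d}"
proof (rule bij_betw_byWitness[where f' = Poly_Mapping.nth])
  have deg: "sum_list (map (Poly_Mapping.lookup m) [0..<Suc n]) = mono_deg m"
    if "Poly_Mapping.keys m \<subseteq> {..n}" for m
    using mono_deg_eq_sum[of "{..n}" m] that
    by (metis atLeast_upt finite_atMost interv_sum_list_conv_sum_set_nat lessThan_Suc_atMost)
  have map_nth_eq: "map (Poly_Mapping.lookup (Poly_Mapping.nth l)) [0..<Suc n] = l"
    if "length l = Suc n" for l :: "nat list"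
    using that by (intro nth_equalityI) (auto simp: nth.rep_eq nth_default_def simp del: upt_Suc)
  have keys: "Poly_Mapping.keys (Poly_Mapping.nth l) \<subseteq> {..n}" if "length l = Suc n"
    for l :: "nat list"
    using that by (auto simp: in_keys_iff nth.rep_eq nth_default_def simp del: keys_nth split: if_splits)
  show "\<forall>m\<in>monomials n d. Poly_Mapping.nth (map (Poly_Mapping.lookup m) [0..<Suc n]) = m"
  proof
    fix m assume "m \<in> monomials n d"
    have "Poly_Mapping.lookup m k = 0" if "n < k" for k
      using that \<open>m \<in> monomials n d\<close> unfolding monomials_def by (auto simp: subset_iff in_keys_iff)
    then show "Poly_Mapping.nth (map (Poly_Mapping.lookup m) [0..<Suc n]) = m"
      by (intro poly_mapping_eqI) (auto simp: nth.rep_eq nth_default_def simp del: upt_Suc)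
  qed
  show "\<forall>l\<in>{l. length l = Suc n \<and> sum_list l = d}.
      map (Poly_Mapping.lookup (Poly_Mapping.nth l)) [0..<Suc n] = l"
    using map_nth_eq by blast
  show "(\<lambda>m. map (Poly_Mapping.lookup m) [0..<Suc n]) ` monomials n d
      \<subseteq> {l. length l = Suc n \<and> sum_list l = d}"
    using deg by (auto simp: monomials_def simp del: upt_Suc)
  show "Poly_Mapping.nth ` {l. length l = Suc n \<and> sum_list l = d} \<subseteq> monomials n d"
  proof clarify
    fix l :: "nat list" assume l: "length l = Suc n"
    have "mono_deg (Poly_Mapping.nth l) = sum_list l"
      using deg[OF keys[OF l]] unfolding map_nth_eq[OF l] by (rule sym)
    then show "Poly_Mapping.nth l \<in> monomials n (sum_list l)"
      using keys[OF l] unfolding monomials_def by blast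
  qed
qed

lemma card_monomials: "card (monomials n d) = num_monomials n (int d)"
  using bij_betw_same_card[OF bij_betw_monomials_lists[of n d]]
  by (simp add: card_length_sum_list num_monomials_def add.commute)

lemma finite_monomials: "finite (monomials n d)"
  by (rule card_ge_0_finite) (simp add: card_monomials num_monomials_def)

lemma lookup_monomial_times:
  fixes f :: "('s::totally_ordered_idempotent_semifield) mpoly"
  shows "Poly_Mapping.lookup (Poly_Mapping.single X 1 * f) (X + m) = Poly_Mapping.lookup f m"
proof -
  have "Poly_Mapping.lookup (Poly_Mapping.single X 1 * f) (X + m) =
     (\<Sum>l. (\<Sum>q. Poly_Mapping.lookup f q when X + m = l + q) when X = l)"
    by (simp add: lookup_mult lookup_single when_mult)
  also have "\<dots> = Poly_Mapping.lookup f m" by simp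
  finally show ?thesis .
qed

lemma keys_monomial_times:
  fixes f :: "('s::totally_ordered_idempotent_semifield) mpoly"
  shows "Poly_Mapping.keys (Poly_Mapping.single X 1 * f) = (+) X ` Poly_Mapping.keys f"
proof
  show "Poly_Mapping.keys (Poly_Mapping.single X 1 * f) \<subseteq> (+) X ` Poly_Mapping.keys f"
    using keys_mult[of "Poly_Mapping.single X 1" f] by auto
  show "(+) X ` Poly_Mapping.keys f \<subseteq> Poly_Mapping.keys (Poly_Mapping.single X 1 * f)"
    by (auto simp: in_keys_iff lookup_monomial_times)
qed


section \<open>The weak image property\<close>

lemma underlying_bases_zero_space:
  assumes "finite E"
  shows "underlying_bases E {\<lambda>_. 0 :: 's::totally_ordered_idempotent_semifield} = {{}}"
proof -
  let ?p = "\<lambda>B. if B = {} then 1 else (0::'s)"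
  have "valuated_matroid E 0 ?p" using assms by (auto simp: valuated_matroid_def)
  moreover have "trop_linear_space E 0 ?p = {\<lambda>_. 0}" by (simp add: trop_linear_space_def)
  ultimately show ?thesis using underlying_bases_eq[of E 0 ?p] by simp
qed

lemma macaulay_minor_eq_trop_minor:
  "macaulay_minor n f d =
     trop_minor (macaulay_matrix f) (monomials n (d - poly_deg f)) (monomials n d)"
  by (rule ext) (simp add: macaulay_minor_def trop_minor_def Let_def)

theorem proposition4p5p1:
  fixes f :: "('s::totally_ordered_idempotent_semifield) mpoly"
    and I :: "'s mpoly set"
    and n :: nat
  assumes "f \<in> polys n" and "f \<noteq> 0" and "homogeneous f"
    and "numerically_principal n (poly_deg f) I"
    and "graded_part I (poly_deg f) = {\<lambda>m. c * Poly_Mapping.lookup f m | c. True}"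
  shows "\<forall>d. weak_image (underlying_bases (monomials n d) (graded_part I d))
                        (underlying_bases (monomials n d) (macaulay_part n f d))"
proof
  fix d
  let ?D = "poly_deg f" and ?E = "monomials n d"
  have "is_trop_linear_space ?E (graded_part I d)"
    using assms(4) by (simp add: numerically_principal_def tropical_ideal_def)
  then obtain r p where p: "valuated_matroid ?E r p"
    and L: "graded_part I d = trop_linear_space ?E r p"
    by (auto simp: is_trop_linear_space_def)
  have "hilbert_function n I d = int (num_monomials n (int d)) - int r"
    unfolding hilbert_function_def L trop_rank_eq[OF p] by simp
  then have r: "r = num_monomials n (int d - int ?D)"
    using assms(4) by (simp add: numerically_principal_def)
  have basesI: "underlying_bases ?E (graded_part I d) = {B. p B \<noteq> 0}"
    using underlying_bases_eq[OF p] L by simp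
  show "weak_image (underlying_bases ?E (graded_part I d))
     (underlying_bases ?E (macaulay_part n f d))"
  proof (cases "d < ?D")
    case True
    have "B = {}" if "p B \<noteq> 0" for B
    proof -
      have "card B = 0" "B \<subseteq> ?E"
        using that p r True by (auto simp: valuated_matroid_def num_monomials_def)
      then show ?thesis using finite_monomials[of n d] by (metis card_0_eq finite_subset)
    qed
    then show ?thesis
      using True underlying_bases_zero_space[OF finite_monomials[of n d], where 's='s]
      unfolding basesI by (auto simp: weak_image_def indep_in_def macaulay_part_def)
  next
    case False
    let ?R = "monomials n (d - ?D)" and ?M = "macaulay_matrix f"
    \<comment> \<open>The order on exponent vectors is the lexicographic one; it is compatible with addition, so the
      leading monomial of \<open>Xf\<close> is \<open>X + \<mu>\<close>.\<close>
    define \<mu> where "\<mu> = Max (Poly_Mapping.keys f)"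
    have kf: "Poly_Mapping.keys f \<noteq> {}" using assms(2) by simp
    have \<mu>: "\<mu> \<in> Poly_Mapping.keys f" "\<And>m. m \<in> Poly_Mapping.keys f \<Longrightarrow> m \<le> \<mu>"
      unfolding \<mu>_def using kf by auto
    have degf: "mono_deg m = ?D" if "m \<in> Poly_Mapping.keys f" for m
    proof -
      obtain e where e: "\<And>m. m \<in> Poly_Mapping.keys f \<Longrightarrow> mono_deg m = e"
        using assms(3) by (auto simp: homogeneous_def homogeneous_of_degree_def)
      then have "mono_deg ` Poly_Mapping.keys f = {e}" using \<mu>(1) by (auto intro!: rev_image_eqI)
      then show ?thesis using e that by (simp add: poly_deg_def)
    qed
    have card_R: "card ?R = r" using False r by (simp add: card_monomials)
    have M_lead: "?M X (X + \<mu>) \<noteq> 0" for X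
      using \<mu>(1) by (simp add: macaulay_matrix_def lookup_monomial_times in_keys_iff)
    have M_above: "?M X e = 0" if "X + \<mu> < e" for X e
    proof (rule ccontr)
      assume "?M X e \<noteq> 0"
      then have "e \<in> (+) X ` Poly_Mapping.keys f"
        unfolding keys_monomial_times[symmetric] by (simp add: macaulay_matrix_def in_keys_iff)
      then show False using that \<mu>(2) by (auto simp: not_less[symmetric])
    qed
    have f_in: "f \<in> I"
    proof -
      have "Poly_Mapping.lookup f \<in> graded_part I ?D"
        unfolding assms(5) by (auto intro: exI[of _ 1])
      then show ?thesis by (auto simp: graded_part_def poly_mapping_eq_iff[symmetric])
    qed
    have rows: "?M X \<in> graded_part I d" if X: "X \<in> ?R" for X
    proof -
      have "Poly_Mapping.single X 1 \<in> polys n" using X by (auto simp: polys_def monomials_def)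
      then have "Poly_Mapping.single X 1 * f \<in> I"
        using assms(4) f_in
        by (auto simp: numerically_principal_def tropical_ideal_def is_homogeneous_ideal_def
            is_ideal_def)
      moreover have "homogeneous_of_degree d (Poly_Mapping.single X 1 * f)"
        using X False degf
        by (auto simp: homogeneous_of_degree_def keys_monomial_times mono_deg_add monomials_def)
      moreover have "?M X = Poly_Mapping.lookup (Poly_Mapping.single X 1 * f)"
        by (rule ext) (simp add: macaulay_matrix_def)
      ultimately show ?thesis by (auto simp: graded_part_def)
    qed
    have minor: "macaulay_minor n f d B \<noteq> 0" if "p B \<noteq> 0" for B
      unfolding macaulay_minor_eq_trop_minor
    proof (rule trop_minor_of_leading_positions[where l = "\<lambda>X. X + \<mu>"])
      show "valuated_matroid ?E (card ?R) p" using p card_R by simp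
      show "inj_on (\<lambda>X. X + \<mu>) ?R" by (simp add: inj_on_def)
      show "?M X \<in> trop_linear_space ?E (card ?R) p" if "X \<in> ?R" for X
        using rows[OF that] L card_R by simp
    qed (use that finite_monomials M_lead M_above in auto)
    \<comment> \<open>A basis of \<open>I\<^sub>d\<close> also shows that the minors do not all vanish.\<close>
    have "\<exists>B. macaulay_minor n f d B \<noteq> 0"
      using p minor by (auto simp: valuated_matroid_def)
    then have "valuated_matroid ?E r (macaulay_minor n f d)"
      using valuated_matroid_trop_minor[OF finite_monomials finite_monomials]
      unfolding macaulay_minor_eq_trop_minor card_R[symmetric] by blast
    then have "underlying_bases ?E (macaulay_part n f d) = {B. macaulay_minor n f d B \<noteq> 0}"
      using False r underlying_bases_eq by (simp add: macaulay_part_def)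
    then show ?thesis
      unfolding basesI weak_image_def indep_in_def using minor by blast
  qed
qed

end
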